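(* Let $K:\mathbb R^d\to\mathbb R$ be continuous and symmetric such that $K(x-y)$ is a (strictly) positive definite kernel with strictly positive Fourier transform $\hat K\in L_1(\mathbb R^d)\cap L_\infty(\mathbb R^d)$, and let $\Omega\subset\mathbb R^d$ be a bounded domain. Let $\varphi_n^E$, $n\ge 0$, be the eigensystem extensions to $\mathbb R^d$ of the Mercer eigenfunctions of $K$ on $\Omega$. Then each $\varphi_n^E$ satisfies the sufficient conditions for superconvergence, i.e. there is $v_n\in L_2(\mathbb R^d)$ vanishing outside $\Omega$ such that $\varphi_n^E=K*v_n$; and consequently $\varphi_n^E\in\mathcal H_K(\Omega)\cap\mathcal H_{K*K}$.
   Context: $\mathcal H_K$ is the reproducing kernel Hilbert space on $\mathbb R^d$ with kernel $K(x-y)$, with inner product $(\cdot,\cdot)_K$. $\mathcal H_K(\Omega)$ is the orthogonal complement in $\mathcal H_K$ of $\{f\in\mathcal H_K: f=0\text{ on }\Omega\}$. $\mathcal H_{K*K}:=\{K*g: g\in L_2(\mathbb R^d)\}$, the space in which the convolved kernel $K*K$ is reproducing. The Mercer eigenfunctions $\varphi_n$ and eigenvalues $\kappa_n>0$, $n\ge 0$, of $K$ on $\Omega$ form a complete $L_2(\Omega)$-orthonormal system of continuous eigenfunctions of the integral operator with kernel $K(x-y)$ on $L_2(\Omega)$: $\kappa_n\varphi_n(x)=\int_\Omega K(x-y)\varphi_n(y)\,dy$ for $x\in\Omega$. The eigensystem extension is defined by $\kappa_n\varphi_n^E(x):=\int_\Omega K(x-y)\varphi_n(y)\,dy$ for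 all $x\in\mathbb R^d$. *)

theory Defs
  imports "HOL-Analysis.Analysis"
begin

definition L2_on :: "'a::euclidean_space set \<Rightarrow> ('a \<Rightarrow> real) set" where
  "L2_on S = {f. set_borel_measurable lborel S f \<and>
                 set_integrable lborel S (\<lambda>x. (f x)\<^sup>2)}"

definition convolution :: "('a::euclidean_space \<Rightarrow> real) \<Rightarrow> ('a \<Rightarrow> real) \<Rightarrow> 'a \<Rightarrow> real" where
  "convolution f g x = (LINT y|lborel. f (x - y) * g y)"

(* The Fourier transform on L2 (Plancherel): F is the L2-limit, as R tends to infinity, of
   the Fourier integrals of f over balls of radius R.  It agrees almost everywhere with the
   Fourier integral if f is also in L1.  A continuous function whose Fourier transform is in
   L1 and L_infinity is in L2 in any case, so the L2 setting is no restriction, whereas the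
   plain Fourier integral would impose f in L1. *)
definition is_fourier_transform ::
    "('a::euclidean_space \<Rightarrow> real) \<Rightarrow> ('a \<Rightarrow> real) \<Rightarrow> bool" where
  "is_fourier_transform f F \<longleftrightarrow>
     f \<in> L2_on UNIV \<and> F \<in> L2_on UNIV \<and>
     ((\<lambda>R. \<integral>\<^sup>+ \<omega>. ennreal ((cmod
         (((2 * pi) powr (- real DIM('a) / 2)) *\<^sub>R
            (LINT x:ball 0 R|lborel. complex_of_real (f x) * cis (- (x \<bullet> \<omega>)))
          - complex_of_real (F \<omega>)))\<^sup>2) \<partial>lborel) \<longlongrightarrow> 0) at_top"

definition strictly_positive_definite :: "('a \<Rightarrow> 'a \<Rightarrow> real) \<Rightarrow> bool" where
  "strictly_positive_definite k \<longleftrightarrow>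
     (\<forall>x y. k x y = k y x) \<and>
     (\<forall>X a. finite X \<longrightarrow> (\<exists>x\<in>X. a x \<noteq> 0) \<longrightarrow>
        0 < (\<Sum>x\<in>X. \<Sum>y\<in>X. a x * a y * k x y))"

(* The real reproducing kernel Hilbert space with kernel k: its underlying set H of functions
   and its inner product ip.  By Moore-Aronszajn, H and the values of ip on H are uniquely
   determined by k, and they exist for every positive definite k. *)
locale rkhs =
  fixes H :: "('a \<Rightarrow> real) set"
    and ip :: "('a \<Rightarrow> real) \<Rightarrow> ('a \<Rightarrow> real) \<Rightarrow> real"
    and k :: "'a \<Rightarrow> 'a \<Rightarrow> real"
  assumes zero_mem: "(\<lambda>x. 0) \<in> H"
    and add_mem: "\<And>f g. f \<in> H \<Longrightarrow> g \<in> H \<Longrightarrow> (\<lambda>x. f x + g x) \<in> H"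
    and scale_mem: "\<And>c f. f \<in> H \<Longrightarrow> (\<lambda>x. c * f x) \<in> H"
    and ip_sym: "\<And>f g. f \<in> H \<Longrightarrow> g \<in> H \<Longrightarrow> ip f g = ip g f"
    and ip_add: "\<And>f g h. f \<in> H \<Longrightarrow> g \<in> H \<Longrightarrow> h \<in> H \<Longrightarrow>
                   ip (\<lambda>x. f x + g x) h = ip f h + ip g h"
    and ip_scale: "\<And>c f g. f \<in> H \<Longrightarrow> g \<in> H \<Longrightarrow> ip (\<lambda>x. c * f x) g = c * ip f g"
    and ip_pos: "\<And>f. f \<in> H \<Longrightarrow> f \<noteq> (\<lambda>x. 0) \<Longrightarrow> 0 < ip f f"
    and complete: "\<And>X :: nat \<Rightarrow> 'a \<Rightarrow> real.
        (\<And>n. X n \<in> H) \<Longrightarrow>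
        (\<forall>e>0. \<exists>N. \<forall>m\<ge>N. \<forall>n\<ge>N.
           sqrt (ip (\<lambda>x. X m x - X n x) (\<lambda>x. X m x - X n x)) < e) \<Longrightarrow>
        (\<exists>f\<in>H. (\<lambda>n. sqrt (ip (\<lambda>x. X n x - f x) (\<lambda>x. X n x - f x))) \<longlonglongrightarrow> 0)"
    and kernel_mem: "\<And>y. (\<lambda>x. k x y) \<in> H"
    and reproducing: "\<And>f y. f \<in> H \<Longrightarrow> f y = ip f (\<lambda>x. k x y)"

definition localized_space ::
    "('a \<Rightarrow> real) set \<Rightarrow> (('a \<Rightarrow> real) \<Rightarrow> ('a \<Rightarrow> real) \<Rightarrow> real) \<Rightarrow> 'a set \<Rightarrow> ('a \<Rightarrow> real) set" where
  "localized_space H ip \<Omega> =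
     {g \<in> H. \<forall>f\<in>H. (\<forall>x\<in>\<Omega>. f x = 0) \<longrightarrow> ip f g = 0}"

definition convolved_space :: "('a::euclidean_space \<Rightarrow> real) \<Rightarrow> ('a \<Rightarrow> real) set" where
  "convolved_space K = {convolution K g | g. g \<in> L2_on UNIV}"

locale mercer_system =
  fixes K :: "'a::euclidean_space \<Rightarrow> real"
    and \<Omega> :: "'a set"
    and \<kappa> :: "nat \<Rightarrow> real"
    and \<phi> :: "nat \<Rightarrow> 'a \<Rightarrow> real"
  assumes eigenvalue_pos: "\<And>n. 0 < \<kappa> n"
    and eigenfunction_continuous: "\<And>n. continuous_on \<Omega> (\<phi> n)"
    and eigenfunction_L2: "\<And>n. \<phi> n \<in> L2_on \<Omega>"
    and orthonormal: "\<And>m n. (LINT x:\<Omega>|lborel. \<phi> m x * \<phi> n x) = (if m = n then 1 else 0)"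
    and complete_system: "\<And>f. f \<in> L2_on \<Omega> \<Longrightarrow>
          (\<And>n. (LINT x:\<Omega>|lborel. f x * \<phi> n x) = 0) \<Longrightarrow>
          (AE x in lborel. x \<in> \<Omega> \<longrightarrow> f x = 0)"
    and eigen_equation: "\<And>n x. x \<in> \<Omega> \<Longrightarrow>
          \<kappa> n * \<phi> n x = (LINT y:\<Omega>|lborel. K (x - y) * \<phi> n y)"

definition eigen_extension ::
    "('a::euclidean_space \<Rightarrow> real) \<Rightarrow> 'a set \<Rightarrow> (nat \<Rightarrow> real) \<Rightarrow> (nat \<Rightarrow> 'a \<Rightarrow> real) \<Rightarrow>
     nat \<Rightarrow> 'a \<Rightarrow> real" where
  "eigen_extension K \<Omega> \<kappa> \<phi> n x = (LINT y:\<Omega>|lborel. K (x - y) * \<phi> n y) / \<kappa> n"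

end

theory Submission
  imports Defs
begin

text \<open>
  Extend \<open>\<phi> n / \<kappa> n\<close> by zero outside \<open>\<Omega>\<close> to a function \<open>v\<close> on the whole space.  The extended
  eigenfunction is \<open>K * v\<close> by its very definition, and \<open>v\<close> is square integrable, which settles
  the source condition and the membership in the convolved space.

  The remaining point is that \<open>K * v\<close> lies in the localized native space.  As \<open>\<Omega>\<close> is bounded,
  \<open>v\<close> is integrable, and \<open>f \<mapsto> \<integral> f v\<close> is a bounded linear functional on the native space,
  because evaluations there are bounded by a constant times the norm.  Its Riesz representer \<open>g\<close>
  (lemma \<open>riesz_representation\<close>) has the values
  \<open>g x = (g, K (\<cdot> - x)) = \<integral> K (y - x) v y dy = (K * v) x\<close>,
  so \<open>K * v\<close> belongs to the native space and \<open>(f, K * v) = \<integral> f v\<close> for all \<open>f\<close> in it (lemma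
  \<open>convolution_mem_rkhs\<close>).  If \<open>f\<close> vanishes on \<open>\<Omega>\<close>, then \<open>f v = 0\<close> everywhere, and \<open>K * v\<close> is
  orthogonal to \<open>f\<close>.
\<close>

section \<open>Quadratic polynomials of constant sign\<close>

lemma discriminant_bound_of_nonneg:
  fixes a b c :: real
  assumes "\<And>t. 0 \<le> a + 2 * t * b + t\<^sup>2 * c" and "0 \<le> c"
  shows "b\<^sup>2 \<le> a * c"
proof (cases "c = 0")
  case True
  have "b = 0"
  proof (rule ccontr)
    assume "b \<noteq> 0"
    \<comment> \<open>At this \<open>t\<close> the affine function \<open>a + 2 * t * b\<close> has the value \<open>- 1\<close>.\<close>
    then show False
      using assms(1)[of "- (a + 1) / (2 * b)"] True by (simp add: field_simps)
  qed
  then show ?thesis using True by simp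
next
  case False
  then have "0 < c" using assms(2) by simp
  have "0 \<le> a + 2 * (- b / c) * b + (- b / c)\<^sup>2 * c"
    by (rule assms(1))
  also have "\<dots> = (a * c - b\<^sup>2) / c"
    using \<open>0 < c\<close> by (simp add: field_simps power2_eq_square)
  finally show ?thesis
    using \<open>0 < c\<close> by (simp add: zero_le_divide_iff)
qed

section \<open>Hilbert space geometry of a reproducing kernel space\<close>

context rkhs
begin

lemma ip_add_right:
  "f \<in> H \<Longrightarrow> g \<in> H \<Longrightarrow> h \<in> H \<Longrightarrow> ip h (\<lambda>x. f x + g x) = ip h f + ip h g"
  using ip_add[of f g h] ip_sym[of h f] ip_sym[of h g] ip_sym[of h "\<lambda>x. f x + g x"] add_mem
  by simp

lemma ip_scale_right: "f \<in> H \<Longrightarrow> g \<in> H \<Longrightarrow> ip g (\<lambda>x. c * f x) = c * ip g f"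
  using ip_scale[of f g c] ip_sym[of g f] ip_sym[of g "\<lambda>x. c * f x"] scale_mem
  by simp

lemma add_scale_mem: "f \<in> H \<Longrightarrow> g \<in> H \<Longrightarrow> (\<lambda>x. f x + c * g x) \<in> H"
  using add_mem[OF _ scale_mem] by simp

lemma ip_add_scale_left:
  "f \<in> H \<Longrightarrow> g \<in> H \<Longrightarrow> h \<in> H \<Longrightarrow> ip (\<lambda>x. f x + c * g x) h = ip f h + c * ip g h"
  using ip_add[of f "\<lambda>x. c * g x" h] ip_scale[of g h c] scale_mem by simp

lemma ip_add_scale_right:
  "f \<in> H \<Longrightarrow> g \<in> H \<Longrightarrow> h \<in> H \<Longrightarrow> ip h (\<lambda>x. f x + c * g x) = ip h f + c * ip h g"
  using ip_add_right[of f "\<lambda>x. c * g x" h] ip_scale_right[of g h c] scale_mem by simp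

lemma ip_add_scale_self:
  assumes "f \<in> H" "g \<in> H"
  shows "ip (\<lambda>x. f x + c * g x) (\<lambda>x. f x + c * g x) = ip f f + 2 * c * ip f g + c\<^sup>2 * ip g g"
  using assms
  by (simp add: ip_add_scale_left ip_add_scale_right add_scale_mem ip_sym[of g f]
      power2_eq_square algebra_simps)

lemma diff_mem: "f \<in> H \<Longrightarrow> g \<in> H \<Longrightarrow> (\<lambda>x. f x - g x) \<in> H"
  using add_scale_mem[of f g "- 1"] by simp

lemma ip_diff_left:
  "f \<in> H \<Longrightarrow> g \<in> H \<Longrightarrow> h \<in> H \<Longrightarrow> ip (\<lambda>x. f x - g x) h = ip f h - ip g h"
  using ip_add_scale_left[of f g h "- 1"] by simp

lemma ip_diff_self:
  "f \<in> H \<Longrightarrow> g \<in> H \<Longrightarrow>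
    ip (\<lambda>x. f x - g x) (\<lambda>x. f x - g x) = ip f f - 2 * ip f g + ip g g"
  using ip_add_scale_self[of f g "- 1"] by simp

lemma ip_zero_left: "f \<in> H \<Longrightarrow> ip (\<lambda>x. 0) f = 0"
  using ip_scale[of f f 0] by simp

lemma ip_self_nonneg: "f \<in> H \<Longrightarrow> 0 \<le> ip f f"
  using ip_pos[of f] ip_zero_left[OF zero_mem] by (cases "f = (\<lambda>x. 0)") auto

lemma cauchy_schwarz:
  assumes "f \<in> H" "g \<in> H"
  shows "(ip f g)\<^sup>2 \<le> ip f f * ip g g"
proof (rule discriminant_bound_of_nonneg)
  show "0 \<le> ip f f + 2 * t * ip f g + t\<^sup>2 * ip g g" for t
    using ip_self_nonneg[OF add_scale_mem[OF assms, of t]] ip_add_scale_self[OF assms, of t]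
    by simp
qed (rule ip_self_nonneg[OF assms(2)])

lemma ip_abs_le: "f \<in> H \<Longrightarrow> g \<in> H \<Longrightarrow> \<bar>ip f g\<bar> \<le> sqrt (ip f f) * sqrt (ip g g)"
  using cauchy_schwarz[of f g] by (metis real_sqrt_abs real_sqrt_le_mono real_sqrt_mult)

lemma abs_eval_le: "f \<in> H \<Longrightarrow> \<bar>f x\<bar> \<le> sqrt (ip f f) * sqrt (k x x)"
  using ip_abs_le[OF _ kernel_mem, of f x] reproducing[of f x]
    reproducing[OF kernel_mem, of x x]
  by simp

text \<open>
  The value \<open>f x - f y\<close> is the inner product of \<open>f\<close> with \<open>k \<cdot> x - k \<cdot> y\<close>.  Hence the kernel
  metric controls the modulus of continuity of every function in the space.
\<close>

lemma abs_eval_diff_le: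
  assumes "f \<in> H"
  shows "\<bar>f x - f y\<bar> \<le> sqrt (ip f f) * sqrt (k x x - 2 * k y x + k y y)"
proof -
  let ?g = "\<lambda>z. k z x - k z y"
  have g: "?g \<in> H"
    by (intro diff_mem kernel_mem)
  have "ip f ?g = ip ?g f"
    by (rule ip_sym[OF assms g])
  also have "\<dots> = f x - f y"
    using assms ip_diff_left[OF kernel_mem[of x] kernel_mem[of y] assms]
      ip_sym[OF assms kernel_mem] reproducing[OF assms] by simp
  finally have "ip f ?g = f x - f y" .
  moreover have "ip ?g ?g = k x x - 2 * k y x + k y y"
    by (simp add: ip_diff_self[OF kernel_mem kernel_mem] reproducing[OF kernel_mem, symmetric])
  ultimately show ?thesis
    using ip_abs_le[OF assms g] by simp
qed

section \<open>Riesz representation\<close>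

text \<open>
  The representer is the minimizer of the energy \<open>J f = (f, f) - 2 L f\<close>, which the boundedness of
  \<open>L\<close> keeps above \<open>- C\<^sup>2\<close>.  The parallelogram law turns almost minimal energy into closeness,
  so that minimizing sequences are Cauchy.  The first variation at the limit vanishes, and this is
  the representation.
\<close>

lemma riesz_representation:
  assumes add: "\<And>f g. f \<in> H \<Longrightarrow> g \<in> H \<Longrightarrow> L (\<lambda>x. f x + g x) = L f + L g"
    and scale: "\<And>c f. f \<in> H \<Longrightarrow> L (\<lambda>x. c * f x) = c * L f"
    and bounded: "\<And>f. f \<in> H \<Longrightarrow> \<bar>L f\<bar> \<le> C * sqrt (ip f f)"
  obtains g where "g \<in> H" "\<And>f. f \<in> H \<Longrightarrow> ip f g = L f"
proof -
  define J where "J f = ip f f - 2 * L f" for f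
  have J_bound: "- C\<^sup>2 \<le> J f" if "f \<in> H" for f
  proof -
    have "0 \<le> (sqrt (ip f f) - C)\<^sup>2" by simp
    also have "\<dots> = ip f f - 2 * (C * sqrt (ip f f)) + C\<^sup>2"
      using ip_self_nonneg[OF that] by (simp add: power2_diff)
    also have "\<dots> \<le> J f + C\<^sup>2"
      using bounded[OF that] by (simp add: J_def)
    finally show ?thesis by simp
  qed
  define d where "d = Inf (J ` H)"
  have bdd: "bdd_below (J ` H)"
    using J_bound by (intro bdd_belowI2)
  have d_le: "d \<le> J f" if "f \<in> H" for f
    unfolding d_def using bdd that by (rule cINF_lower)
  have "\<exists>f\<in>H. J f < d + 1 / real (Suc n)" for n
    using cInf_lessD[of "J ` H" "d + 1 / real (Suc n)"] zero_mem
    by (auto simp: d_def)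
  then obtain X where X: "\<And>n. X n \<in> H" and JX: "\<And>n. J (X n) < d + 1 / real (Suc n)"
    by metis
  have L_add_scale: "L (\<lambda>x. f x + c * g x) = L f + c * L g" if "f \<in> H" "g \<in> H" for f g c
    using that add[of f "\<lambda>x. c * g x"] scale[of g c] scale_mem by simp

  \<comment> \<open>The energy of the midpoint is at least \<open>d\<close>, and the linear terms cancel.\<close>
  have parallelogram:
    "ip (\<lambda>x. f x - g x) (\<lambda>x. f x - g x) \<le> 2 * (J f - d) + 2 * (J g - d)"
    if "f \<in> H" "g \<in> H" for f g
  proof -
    let ?m = "\<lambda>x. 1 / 2 * (f x + 1 * g x)"
    have s: "(\<lambda>x. f x + 1 * g x) \<in> H" by (rule add_scale_mem[OF that])
    have m: "?m \<in> H" by (rule scale_mem[OF s])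
    have "L ?m = 1 / 2 * (L f + L g)"
      using scale[OF s, of "1/2"] L_add_scale[OF that, of 1] by simp
    moreover have "ip ?m ?m = 1 / 4 * (ip f f + 2 * ip f g + ip g g)"
      using ip_scale[OF s m, of "1/2"] ip_scale_right[OF s s, of "1/2"]
        ip_add_scale_self[OF that, of 1] by simp
    ultimately show ?thesis
      using d_le[OF m] ip_diff_self[OF that] by (simp add: J_def)
  qed

  have "\<exists>N. \<forall>m\<ge>N. \<forall>n\<ge>N. sqrt (ip (\<lambda>x. X m x - X n x) (\<lambda>x. X m x - X n x)) < e"
    if "0 < e" for e
  proof -
    from reals_Archimedean[of "e\<^sup>2 / 4"] that
    obtain N where N: "1 / real (Suc N) < e\<^sup>2 / 4"
      by (auto simp: inverse_eq_divide)
    have small: "J (X n) - d < e\<^sup>2 / 4" if "n \<ge> N" for n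
    proof -
      have "1 / real (Suc n) \<le> 1 / real (Suc N)"
        using that by (intro divide_left_mono) auto
      then show ?thesis using JX[of n] N by linarith
    qed
    have "sqrt (ip (\<lambda>x. X m x - X n x) (\<lambda>x. X m x - X n x)) < e" if "m \<ge> N" "n \<ge> N" for m n
    proof -
      have "ip (\<lambda>x. X m x - X n x) (\<lambda>x. X m x - X n x) < e\<^sup>2"
        using parallelogram[OF X X, of m n] small[OF that(1)] small[OF that(2)] by simp
      then show ?thesis
        using \<open>0 < e\<close> by (simp add: real_less_lsqrt)
    qed
    then show ?thesis by blast
  qed
  then obtain g where g: "g \<in> H"
    and lim: "(\<lambda>n. sqrt (ip (\<lambda>x. X n x - g x) (\<lambda>x. X n x - g x))) \<longlonglongrightarrow> 0"
    using complete[of X] X by blast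

  have "ip h g = L h" if h: "h \<in> H" for h
  proof -
    have "(\<lambda>n. ip (X n) h - ip g h) \<longlonglongrightarrow> 0"
    proof (rule Lim_null_comparison)
      show "\<forall>\<^sub>F n in sequentially. norm (ip (X n) h - ip g h)
          \<le> sqrt (ip (\<lambda>x. X n x - g x) (\<lambda>x. X n x - g x)) * sqrt (ip h h)"
        using ip_abs_le[OF diff_mem[OF X g] h] ip_diff_left[OF X g h]
        by (intro always_eventually) simp
      show "(\<lambda>n. sqrt (ip (\<lambda>x. X n x - g x) (\<lambda>x. X n x - g x)) * sqrt (ip h h)) \<longlonglongrightarrow> 0"
        using tendsto_mult_right[OF lim, of "sqrt (ip h h)"] by simp
    qed
    then have lim_ip: "(\<lambda>n. ip (X n) h) \<longlonglongrightarrow> ip g h"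
      by (simp add: LIM_zero_iff)

    \<comment> \<open>Perturbing \<open>X n\<close> by \<open>t * h\<close> lowers its energy by at most its excess over \<open>d\<close>, which is
      below \<open>1 / Suc n\<close>.\<close>
    have variation: "0 \<le> 0 + 2 * t * (ip g h - L h) + t\<^sup>2 * ip h h" for t
    proof (rule tendsto_lowerbound)
      show "(\<lambda>n. 1 / real (Suc n) + 2 * t * (ip (X n) h - L h) + t\<^sup>2 * ip h h)
          \<longlonglongrightarrow> 0 + 2 * t * (ip g h - L h) + t\<^sup>2 * ip h h"
        by (intro tendsto_intros lim_ip LIMSEQ_Suc[OF lim_1_over_n])
      show "\<forall>\<^sub>F n in sequentially.
          0 \<le> 1 / real (Suc n) + 2 * t * (ip (X n) h - L h) + t\<^sup>2 * ip h h"
      proof (intro always_eventually allI)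
        fix n
        have "d \<le> J (\<lambda>x. X n x + t * h x)"
          by (rule d_le[OF add_scale_mem[OF X h]])
        also have "\<dots> = J (X n) + 2 * t * (ip (X n) h - L h) + t\<^sup>2 * ip h h"
          using ip_add_scale_self[OF X h] L_add_scale[OF X h]
          by (simp add: J_def algebra_simps)
        finally show "0 \<le> 1 / real (Suc n) + 2 * t * (ip (X n) h - L h) + t\<^sup>2 * ip h h"
          using JX[of n] by linarith
      qed
    qed simp
    have "(ip g h - L h)\<^sup>2 \<le> 0 * ip h h"
      using variation ip_self_nonneg[OF h] by (rule discriminant_bound_of_nonneg)
    then show ?thesis
      using ip_sym[OF g h] by simp
  qed
  with g show thesis by (rule that)
qed

end

section \<open>Convolution of a translation-invariant kernel with an integrable function\<close>

text \<open>
  For a translation-invariant kernel with continuous \<open>K\<close> the kernel metric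
  \<open>sqrt (2 * K 0 - 2 * K (x - y))\<close> tends to zero with \<open>x - y\<close>, and its multiple by
  the norm of \<open>f\<close> dominates \<open>f x - f y\<close>.
\<close>

lemma rkhs_translation_invariant_continuous:
  fixes K :: "'a::euclidean_space \<Rightarrow> real"
  assumes "rkhs H ip (\<lambda>x y. K (x - y))" and "continuous_on UNIV K" and "f \<in> H"
  shows "continuous_on UNIV f"
proof -
  interpret rkhs H ip "\<lambda>x y. K (x - y)" by (rule assms(1))
  have "(f \<longlongrightarrow> f x) (at x)" for x
  proof -
    have K: "((\<lambda>y. K (x - y)) \<longlongrightarrow> K (x - x)) (at x)"
      using assms(2)
      by (intro isCont_tendsto_compose[of _ K] tendsto_intros)
        (simp add: continuous_on_eq_continuous_within)
    have "((\<lambda>y. f y - f x) \<longlongrightarrow> 0) (at x)"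
    proof (rule Lim_null_comparison)
      show "\<forall>\<^sub>F y in at x. norm (f y - f x)
          \<le> sqrt (ip f f) * sqrt (2 * K 0 - 2 * K (x - y))"
        using abs_eval_diff_le[OF assms(3), of _ x]
        by (intro always_eventually allI) (simp add: algebra_simps)
      have "((\<lambda>y. sqrt (ip f f) * sqrt (2 * K 0 - 2 * K (x - y)))
          \<longlongrightarrow> sqrt (ip f f) * sqrt (2 * K 0 - 2 * K (x - x))) (at x)"
        by (intro tendsto_intros K)
      then show "((\<lambda>y. sqrt (ip f f) * sqrt (2 * K 0 - 2 * K (x - y))) \<longlongrightarrow> 0) (at x)"
        by simp
    qed
    then show ?thesis by (rule LIM_zero_cancel)
  qed
  then show ?thesis by (simp add: continuous_on_def)
qed

text \<open>
  \<open>K * v\<close> is the Riesz representer of integration against \<open>v\<close>, as testing it with the translates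
  of the kernel shows.
\<close>

lemma convolution_mem_rkhs:
  fixes K v :: "'a::euclidean_space \<Rightarrow> real"
  assumes H: "rkhs H ip (\<lambda>x y. K (x - y))"
    and cont: "continuous_on UNIV K" and even: "\<And>x. K (- x) = K x"
    and v: "integrable lborel v"
  shows "convolution K v \<in> H"
    and "\<And>f. f \<in> H \<Longrightarrow> ip f (convolution K v) = (LINT y|lborel. f y * v y)"
proof -
  interpret rkhs H ip "\<lambda>x y. K (x - y)" by (rule H)
  define L where "L f = (LINT y|lborel. f y * v y)" for f
  have bound: "\<bar>f y * v y\<bar> \<le> sqrt (ip f f) * sqrt (K 0) * \<bar>v y\<bar>" if "f \<in> H" for f y
    using abs_eval_le[OF that, of y] by (simp add: abs_mult mult_right_mono)
  have int: "integrable lborel (\<lambda>y. f y * v y)" if "f \<in> H" for f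
  proof (rule Bochner_Integration.integrable_bound)
    show "integrable lborel (\<lambda>y. sqrt (ip f f) * sqrt (K 0) * \<bar>v y\<bar>)"
      using v by (intro integrable_mult_right integrable_abs)
    have "f \<in> borel_measurable borel"
      using rkhs_translation_invariant_continuous[OF H cont that]
      by (rule borel_measurable_continuous_onI)
    then show "(\<lambda>y. f y * v y) \<in> borel_measurable lborel"
      using v by simp
    show "AE y in lborel. norm (f y * v y) \<le> norm (sqrt (ip f f) * sqrt (K 0) * \<bar>v y\<bar>)"
    proof (rule AE_I2)
      fix y
      show "norm (f y * v y) \<le> norm (sqrt (ip f f) * sqrt (K 0) * \<bar>v y\<bar>)"
        using bound[OF that, of y] by (simp add: order_trans[OF _ abs_ge_self])
    qed
  qed
  have L_add: "L (\<lambda>x. f x + g x) = L f + L g" if "f \<in> H" "g \<in> H" for f g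
    using int that by (simp add: L_def distrib_right)
  have L_scale: "L (\<lambda>x. c * f x) = c * L f" for c f
    by (simp add: L_def mult.assoc)
  have L_bounded: "\<bar>L f\<bar> \<le> (sqrt (K 0) * (LINT y|lborel. \<bar>v y\<bar>)) * sqrt (ip f f)"
    if "f \<in> H" for f
  proof -
    have "\<bar>L f\<bar> \<le> (LINT y|lborel. \<bar>f y * v y\<bar>)"
      unfolding L_def by (rule integral_abs_bound)
    also have "\<dots> \<le> (LINT y|lborel. sqrt (ip f f) * sqrt (K 0) * \<bar>v y\<bar>)"
      using int[OF that] v bound[OF that] by (intro integral_mono) auto
    finally show ?thesis by (simp add: mult_ac)
  qed
  obtain g where g: "g \<in> H" and rep: "\<And>f. f \<in> H \<Longrightarrow> ip f g = L f"
    using riesz_representation[of L, OF L_add L_scale L_bounded] by blast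
  have "g x = convolution K v x" for x
  proof -
    have "g x = ip (\<lambda>y. K (y - x)) g"
      using reproducing[OF g] ip_sym[OF g kernel_mem] by simp
    also have "\<dots> = (LINT y|lborel. K (y - x) * v y)"
      using rep[OF kernel_mem] by (simp add: L_def)
    also have "\<dots> = convolution K v x"
      unfolding convolution_def by (simp add: even[of "x - _", simplified])
    finally show ?thesis .
  qed
  then have "g = convolution K v" by (rule ext)
  with g rep show "convolution K v \<in> H"
    and "\<And>f. f \<in> H \<Longrightarrow> ip f (convolution K v) = (LINT y|lborel. f y * v y)"
    by (auto simp: L_def)
qed

lemma L2_on_finite_measure_imp_set_integrable:
  assumes "f \<in> L2_on S" and "S \<in> sets lborel" and "emeasure lborel S < \<infinity>"
  shows "set_integrable lborel S f"
proof -
  have one: "integrable lborel (indicator S :: _ \<Rightarrow> real)"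
    using assms(2,3) by (simp add: integrable_indicator_iff)
  have sq: "integrable lborel (\<lambda>x. indicator S x *\<^sub>R (f x)\<^sup>2)"
    and meas: "(\<lambda>x. indicator S x *\<^sub>R f x) \<in> borel_measurable lborel"
    using assms(1) by (simp_all add: L2_on_def set_integrable_def set_borel_measurable_def)
  show ?thesis
    unfolding set_integrable_def
  proof (rule Bochner_Integration.integrable_bound[OF Bochner_Integration.integrable_add[OF one sq] meas],
      rule AE_I2)
    fix x
    have "0 \<le> (\<bar>f x\<bar> - 1)\<^sup>2 + (f x)\<^sup>2 + 1" by simp
    then have "\<bar>f x\<bar> \<le> 1 + (f x)\<^sup>2" by (simp add: power2_diff)
    then show "norm (indicator S x *\<^sub>R f x) \<le> norm (indicator S x + indicator S x *\<^sub>R (f x)\<^sup>2)"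
      by (simp add: indicator_def)
  qed
qed

theorem mainTheorem7:
  fixes K Khat :: "'a::euclidean_space \<Rightarrow> real"
    and \<Omega> :: "'a set"
    and HK :: "('a \<Rightarrow> real) set"
    and ip :: "('a \<Rightarrow> real) \<Rightarrow> ('a \<Rightarrow> real) \<Rightarrow> real"
    and \<kappa> :: "nat \<Rightarrow> real"
    and \<phi> :: "nat \<Rightarrow> 'a \<Rightarrow> real"
  assumes "continuous_on UNIV K"
    and "\<And>x. K (- x) = K x"
    and "strictly_positive_definite (\<lambda>x y. K (x - y))"
    and "is_fourier_transform K Khat"
    and "\<And>\<omega>. 0 < Khat \<omega>"
    and "integrable lborel Khat"
    and "\<exists>C. AE \<omega> in lborel. \<bar>Khat \<omega>\<bar> \<le> C"
    and "open \<Omega>" and "connected \<Omega>" and "\<Omega> \<noteq> {}" and "bounded \<Omega>"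
    and "rkhs HK ip (\<lambda>x y. K (x - y))"
    and "mercer_system K \<Omega> \<kappa> \<phi>"
  shows "\<forall>n. (\<exists>v\<in>L2_on UNIV. (\<forall>x. x \<notin> \<Omega> \<longrightarrow> v x = 0) \<and>
                 eigen_extension K \<Omega> \<kappa> \<phi> n = convolution K v) \<and>
             eigen_extension K \<Omega> \<kappa> \<phi> n \<in> localized_space HK ip \<Omega> \<inter> convolved_space K"
proof (intro allI conjI)
  fix n
  interpret mercer_system K \<Omega> \<kappa> \<phi> by (rule assms(13))
  let ?E = "eigen_extension K \<Omega> \<kappa> \<phi> n"
  define v where "v x = indicator \<Omega> x * \<phi> n x / \<kappa> n" for x
  have E: "?E = convolution K v"
    by (rule ext) (simp add: eigen_extension_def convolution_def v_def set_lebesgue_integral_def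
        mult_ac)
  have v_zero: "\<forall>x. x \<notin> \<Omega> \<longrightarrow> v x = 0"
    by (simp add: v_def)

  have sq: "integrable lborel (\<lambda>x. indicator \<Omega> x * (\<phi> n x)\<^sup>2)"
    and meas: "(\<lambda>x. indicator \<Omega> x * \<phi> n x) \<in> borel_measurable lborel"
    using eigenfunction_L2[of n]
    by (simp_all add: L2_on_def set_integrable_def set_borel_measurable_def)
  have "(\<lambda>x. (v x)\<^sup>2) = (\<lambda>x. indicator \<Omega> x * (\<phi> n x)\<^sup>2 / (\<kappa> n)\<^sup>2)"
    by (auto simp: v_def indicator_def power_divide)
  then have "integrable lborel (\<lambda>x. (v x)\<^sup>2)"
    using sq by simp
  moreover have "v \<in> borel_measurable lborel"
    unfolding v_def using meas by (rule borel_measurable_divide) simp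
  ultimately have v_L2: "v \<in> L2_on UNIV"
    by (simp add: L2_on_def set_integrable_def set_borel_measurable_def)

  have "set_integrable lborel \<Omega> (\<phi> n)"
    using eigenfunction_L2 emeasure_bounded_finite[OF assms(11)] assms(8)
    by (intro L2_on_finite_measure_imp_set_integrable) auto
  then have v_int: "integrable lborel v"
    unfolding v_def set_integrable_def real_scaleR_def by (rule integrable_divide)
  note riesz = convolution_mem_rkhs[OF assms(12,1,2) v_int]
  have "ip f (convolution K v) = 0" if "f \<in> HK" and "\<forall>x\<in>\<Omega>. f x = 0" for f
  proof -
    have vanish: "(\<lambda>y. f y * v y) = (\<lambda>y. 0)"
      using that(2) v_zero by (metis mult_eq_0_iff)
    show ?thesis
      using riesz(2)[OF that(1)] unfolding vanish by simp
  qed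
  then have "?E \<in> localized_space HK ip \<Omega>"
    using riesz(1) by (simp add: E localized_space_def)
  moreover have "?E \<in> convolved_space K"
    using v_L2 E by (auto simp: convolved_space_def)
  ultimately show "?E \<in> localized_space HK ip \<Omega> \<inter> convolved_space K" by blast
  show "\<exists>v\<in>L2_on UNIV. (\<forall>x. x \<notin> \<Omega> \<longrightarrow> v x = 0) \<and> ?E = convolution K v"
    using v_L2 v_zero E by blast
qed

end
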